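(* Assume that $\big(A(t),B(t)\big)$, $t\in\mathbb{R}$, is totally controllable on $\mathbb{R}$. Let $s\in\mathbb{R}$, let $\Pi_s\in\mathbb{R}^{n\times n}$ be symmetric, and let $\mathcal{I}_s\subset\mathbb{R}$ be the maximal interval of existence of the solution to $$\dot{\Pi} = - A(t)^{T} \Pi - \Pi A(t) + \Pi B(t) B(t)^{T} \Pi - Q(t)$$ starting from $\Pi(s)=\Pi_s$. Then $\mathcal{I}_s=(t_0,t_1)$, where $$t_{0} = \inf \big\{t:\ t < s,\ - \Phi_{12}(t, s)^{-1} \Phi_{11}(t, s) \prec \Pi_{s}\big\},$$ $$t_{1} = \sup \big\{t:\ t > s,\ - \Phi_{12}(t, s)^{-1} \Phi_{11}(t, s) \succ \Pi_{s}\big\}$$ (with values in $[-\infty,+\infty]$).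
   Context: $A:\mathbb{R}\to\mathbb{R}^{n\times n}$ is $(n-1)$-times and $B:\mathbb{R}\to\mathbb{R}^{n\times p}$ is $n$-times continuously differentiable; $Q:\mathbb{R}\to\mathbb{R}^{n\times n}$ is continuous and symmetric with $Q(t)\succeq0$. $\prec,\succ,\succeq$ denote the Loewner order on symmetric matrices. $\Phi_M(t,s)=\begin{bmatrix}\Phi_{11}(t,s)&\Phi_{12}(t,s)\\ \Phi_{21}(t,s)&\Phi_{22}(t,s)\end{bmatrix}$ ($n\times n$ blocks) is the state transition matrix of $M(t)=\begin{bmatrix}A(t)&-B(t)B(t)^{T}\\-Q(t)&-A(t)^{T}\end{bmatrix}$, i.e. $\frac{\partial}{\partial t}\Phi_M(t,s)=M(t)\Phi_M(t,s)$, $\Phi_M(s,s)=I_{2n}$. Under total controllability, $\Phi_{12}(t,s)$ is invertible for $t\ne s$. Total controllability on $\mathbb{R}$: let $\Gamma_0(t)=B(t)$, $\Gamma_k(t)=-A(t)\Gamma_{k-1}(t)+\dot\Gamma_{k-1}(t)$ for $k\ge1$, and $\Theta_n(t)=[\Gamma_0(t)\ \cdots\ \Gamma_{n-1}(t)]$; for all real $a<b$ there is $t\in(a,b)$ with $\operatorname{rank}\Theta_n(t)=n$. *)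

theory Defs
  imports "HOL-Analysis.Analysis"
begin

primrec times_cont_diff :: "nat \<Rightarrow> (real \<Rightarrow> 'a::real_normed_vector) \<Rightarrow> bool" where
  "times_cont_diff 0 f \<longleftrightarrow> continuous_on UNIV f"
| "times_cont_diff (Suc k) f \<longleftrightarrow>
     (\<forall>t. f differentiable (at t)) \<and> times_cont_diff k (\<lambda>t. vector_derivative f (at t))"

definition sym_matrix :: "real^'n^'n \<Rightarrow> bool" where
  "sym_matrix X \<longleftrightarrow> transpose X = X"

definition loewner_le :: "real^'n^'n \<Rightarrow> real^'n^'n \<Rightarrow> bool"  (infix \<open>\<preceq>\<^sub>L\<close> 50) where
  "X \<preceq>\<^sub>L Y \<longleftrightarrow> sym_matrix X \<and> sym_matrix Y \<and> (\<forall>v. 0 \<le> v \<bullet> ((Y - X) *v v))"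

definition loewner_less :: "real^'n^'n \<Rightarrow> real^'n^'n \<Rightarrow> bool"  (infix \<open>\<prec>\<^sub>L\<close> 50) where
  "X \<prec>\<^sub>L Y \<longleftrightarrow> sym_matrix X \<and> sym_matrix Y \<and> (\<forall>v. v \<noteq> 0 \<longrightarrow> 0 < v \<bullet> ((Y - X) *v v))"

(* Two-by-two block matrices have the disjoint sum 'n + 'n as index type, so they have
   size 2n; Inl indexes the first and Inr the second block row or column. *)

definition block_matrix ::
  "real^'n^'n \<Rightarrow> real^'n^'n \<Rightarrow> real^'n^'n \<Rightarrow> real^'n^'n \<Rightarrow> real^('n + 'n)^('n + 'n)" where
  "block_matrix X11 X12 X21 X22 =
     (\<chi> i j. case i of
        Inl k \<Rightarrow> (case j of Inl l \<Rightarrow> X11 $ k $ l | Inr l \<Rightarrow> X12 $ k $ l)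
      | Inr k \<Rightarrow> (case j of Inl l \<Rightarrow> X21 $ k $ l | Inr l \<Rightarrow> X22 $ k $ l))"

definition block11 :: "real^('n + 'n)^('n + 'n) \<Rightarrow> real^'n^'n" where
  "block11 X = (\<chi> i j. X $ Inl i $ Inl j)"

definition block12 :: "real^('n + 'n)^('n + 'n) \<Rightarrow> real^'n^'n" where
  "block12 X = (\<chi> i j. X $ Inl i $ Inr j)"

definition hamiltonian ::
  "(real \<Rightarrow> real^'n^'n) \<Rightarrow> (real \<Rightarrow> real^'p^'n) \<Rightarrow> (real \<Rightarrow> real^'n^'n) \<Rightarrow> real
     \<Rightarrow> real^('n + 'n)^('n + 'n)" where
  "hamiltonian A B Q t =
     block_matrix (A t) (- (B t ** transpose (B t))) (- Q t) (- transpose (A t))"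

definition state_transition_matrix ::
  "(real \<Rightarrow> real^'m^'m) \<Rightarrow> (real \<Rightarrow> real \<Rightarrow> real^'m^'m) \<Rightarrow> bool" where
  "state_transition_matrix M \<Phi> \<longleftrightarrow>
     (\<forall>s. \<Phi> s s = mat 1) \<and>
     (\<forall>t s. ((\<lambda>\<tau>. \<Phi> \<tau> s) has_vector_derivative M t ** \<Phi> t s) (at t))"

primrec ctrb_Gamma ::
  "(real \<Rightarrow> real^'n^'n) \<Rightarrow> (real \<Rightarrow> real^'p^'n) \<Rightarrow> nat \<Rightarrow> real \<Rightarrow> real^'p^'n" where
  "ctrb_Gamma A B 0 = B"
| "ctrb_Gamma A B (Suc k) =
     (\<lambda>t. - (A t ** ctrb_Gamma A B k t) + vector_derivative (ctrb_Gamma A B k) (at t))"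

(* The n-by-(n p) matrix with block columns Gamma_0, ..., Gamma_(n-1), n = CARD('n).
   Its columns are indexed by pairs (k, j): column j of the block whose number is given by
   the bijection to_nat_on UNIV from 'n onto {..<CARD('n)}. *)

definition ctrb_Theta ::
  "(real \<Rightarrow> real^'n^'n) \<Rightarrow> (real \<Rightarrow> real^'p^'n) \<Rightarrow> real \<Rightarrow> real^('n \<times> 'p)^'n" where
  "ctrb_Theta A B t =
     (\<chi> i kj. ctrb_Gamma A B (to_nat_on (UNIV :: 'n set) (fst kj)) t $ i $ snd kj)"

definition totally_controllable ::
  "(real \<Rightarrow> real^'n^'n) \<Rightarrow> (real \<Rightarrow> real^'p^'n) \<Rightarrow> bool" where
  "totally_controllable A B \<longleftrightarrow>
     (\<forall>a b. a < b \<longrightarrow> (\<exists>t\<in>{a<..<b}. rank (ctrb_Theta A B t) = CARD('n)))"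

definition solves_ivp_on ::
  "(real \<Rightarrow> 'a \<Rightarrow> 'a) \<Rightarrow> real \<Rightarrow> 'a \<Rightarrow> (real \<Rightarrow> 'a::real_normed_vector) \<Rightarrow> real set \<Rightarrow> bool" where
  "solves_ivp_on f s x0 x J \<longleftrightarrow>
     x s = x0 \<and> (\<forall>t\<in>J. (x has_vector_derivative f t (x t)) (at t within J))"

(* The union of all intervals around s that carry a solution.  For a right-hand side that is
   continuous in t and locally Lipschitz in the state, such as that of the Riccati equation,
   solutions agree on common intervals, so this is the domain of the unique
   non-continuable solution. *)

definition max_existence_interval ::
  "(real \<Rightarrow> 'a \<Rightarrow> 'a) \<Rightarrow> real \<Rightarrow> 'a::real_normed_vector \<Rightarrow> real set" where
  "max_existence_interval f s x0 =
     \<Union> {J. is_interval J \<and> s \<in> J \<and> (\<exists>x. solves_ivp_on f s x0 x J)}"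

definition riccati_rhs ::
  "(real \<Rightarrow> real^'n^'n) \<Rightarrow> (real \<Rightarrow> real^'p^'n) \<Rightarrow> (real \<Rightarrow> real^'n^'n)
     \<Rightarrow> real \<Rightarrow> real^'n^'n \<Rightarrow> real^'n^'n" where
  "riccati_rhs A B Q t P =
     - (transpose (A t) ** P) - P ** A t + P ** B t ** transpose (B t) ** P - Q t"

end

theory Submission
  imports Defs
begin

text \<open>
  A pair \<open>(x, y)\<close> is a trajectory if it solves the Hamiltonian system
  \<open>x' = A x - B B\<^sup>T y\<close>, \<open>y' = - Q x - A\<^sup>T y\<close>. The Riccati equation describes the slope of a
  Lagrangian subspace moving with this flow: if the matrices \<open>X, Y\<close> form a trajectory from
  \<open>X(s) = I\<close>, \<open>Y(s) = \<Pi>\<^sub>s\<close>, then \<open>Y X\<^sup>-\<^sup>1\<close> solves the Riccati equation where \<open>X\<close> is invertible.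
  Conversely, a solution \<open>P\<close> forces \<open>Y = P X\<close>, so that \<open>X v = 0\<close> at one time makes the whole
  trajectory through \<open>v\<close> vanish. Hence \<open>t\<close> lies in the maximal interval iff \<open>X\<close> is invertible
  on the whole segment between \<open>s\<close> and \<open>t\<close> (\<open>mem_max_existence_interval_iff\<close>), and since
  \<open>det X\<close> is continuous, that interval is open.

  Write \<open>S(t) = - \<Phi>\<^sub>1\<^sub>2(t,s)\<^sup>-\<^sup>1 \<Phi>\<^sub>1\<^sub>1(t,s)\<close>. The costate \<open>S(t) v\<close> is the one that steers the state
  from \<open>v\<close> at time \<open>s\<close> to \<open>0\<close> at time \<open>t\<close>. The inverse exists because a trajectory whose
  state vanishes at two times is trivial: \<open>x \<bullet> y\<close> is nonincreasing, hence zero in between, so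
  \<open>B\<^sup>T y = 0\<close> and \<open>Q x = 0\<close> there, and differentiating \<open>B\<^sup>T y = 0\<close> shows that \<open>y\<close> is orthogonal
  to every \<open>\<Gamma>\<^sub>k\<close> (\<open>trajectory_between_zeros_trivial\<close>).

  The theorem reduces to the claim that, for \<open>t \<noteq> s\<close>, \<open>X\<close> is invertible on the segment between
  \<open>s\<close> and \<open>t\<close> iff \<open>(t - s) (S(t) - \<Pi>\<^sub>s)\<close> is positive definite. If \<open>X\<close> is invertible there, let
  \<open>P = Y X\<^sup>-\<^sup>1\<close> and let \<open>(x, y)\<close> be the steering trajectory. Completing the square gives
  \<open>(x \<bullet> (y - P x))' = - |B\<^sup>T (y - P x)|\<^sup>2\<close>. The function vanishes at \<open>t\<close> and equals
  \<open>v \<bullet> (S(t) - \<Pi>\<^sub>s) v\<close> at \<open>s\<close> (\<open>riccati_below_steering_costate\<close>). If instead \<open>X(r) v = 0\<close> for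
  some \<open>r\<close> in the segment, the monotonicity of \<open>x \<bullet> y\<close> along the steering trajectory and
  along its difference from \<open>(X v, Y v)\<close> gives \<open>(t - s) (v \<bullet> (S(t) - \<Pi>\<^sub>s) v) \<le> 0\<close>
  (\<open>steering_costate_below_conjugate_trajectory\<close>). In terms of optimal control, \<open>v \<bullet> S(t) v\<close>
  is for \<open>t > s\<close> the least cost of reaching the origin at time \<open>t\<close>, and following
  \<open>(X v, Y v)\<close> up to time \<open>r\<close> and resting afterwards reaches it at cost \<open>v \<bullet> \<Pi>\<^sub>s v\<close>.

  The factor \<open>t - s\<close> treats both time directions at once. Because the interval is open, \<open>t\<close>
  belongs to it iff definiteness holds at some time beyond \<open>t\<close> as seen from \<open>s\<close>, and this is
  the strict comparison with the supremum or infimum in the theorem.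
\<close>

section \<open>Matrices and their inverses\<close>

text \<open>The proofs move \<open>B\<^sup>T\<close> and \<open>A\<^sup>T\<close> across inner products with \<open>inner_transpose_right\<close>; this needs
  products with a transpose to keep their form instead of turning into \<open>y v* A\<close>.\<close>

declare transpose_matrix_vector [simp del]

lemma bounded_bilinear_matrix_matrix_mult:
  "bounded_bilinear ((**) :: real^'n^'m \<Rightarrow> real^'p^'n \<Rightarrow> real^'p^'m)"
  unfolding bilinear_conv_bounded_bilinear[symmetric] bilinear_def linear_iff
  by (auto simp: vec_eq_iff matrix_matrix_mult_def algebra_simps sum.distrib sum_distrib_left)

lemma bounded_bilinear_matrix_vector_mult:
  "bounded_bilinear ((*v) :: real^'n^'m \<Rightarrow> real^'n \<Rightarrow> real^'m)"
  unfolding bilinear_conv_bounded_bilinear[symmetric] bilinear_def linear_iff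
  by (auto simp: vec_eq_iff matrix_vector_mult_def algebra_simps sum.distrib sum_distrib_left)

lemma bounded_linear_transpose: "bounded_linear (transpose :: real^'n^'m \<Rightarrow> real^'m^'n)"
  unfolding linear_conv_bounded_linear[symmetric] linear_iff
  by (simp add: vec_eq_iff transpose_def)

lemmas matrix_mult_simps =
  bounded_bilinear.add_left[OF bounded_bilinear_matrix_matrix_mult]
  bounded_bilinear.add_right[OF bounded_bilinear_matrix_matrix_mult]
  bounded_bilinear.diff_left[OF bounded_bilinear_matrix_matrix_mult]
  bounded_bilinear.diff_right[OF bounded_bilinear_matrix_matrix_mult]
  bounded_bilinear.minus_left[OF bounded_bilinear_matrix_matrix_mult]
  bounded_bilinear.minus_right[OF bounded_bilinear_matrix_matrix_mult]

lemmas matrix_vector_mult_simps =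
  bounded_bilinear.add_left[OF bounded_bilinear_matrix_vector_mult]
  bounded_bilinear.add_right[OF bounded_bilinear_matrix_vector_mult]
  bounded_bilinear.diff_left[OF bounded_bilinear_matrix_vector_mult]
  bounded_bilinear.diff_right[OF bounded_bilinear_matrix_vector_mult]
  bounded_bilinear.minus_left[OF bounded_bilinear_matrix_vector_mult]
  bounded_bilinear.minus_right[OF bounded_bilinear_matrix_vector_mult]

lemmas continuous_on_matrix_mult [continuous_intros] =
  bounded_bilinear.continuous_on[OF bounded_bilinear_matrix_matrix_mult]
lemmas continuous_on_matrix_vector_mult [continuous_intros] =
  bounded_bilinear.continuous_on[OF bounded_bilinear_matrix_vector_mult]
lemmas continuous_on_transpose [continuous_intros] =
  bounded_linear.continuous_on[OF bounded_linear_transpose]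

lemma inner_transpose_right: "v \<bullet> (transpose M *v w) = (M *v v) \<bullet> w"
  for M :: "real^'n^'m"
  by (metis dot_lmul_matrix inner_commute transpose_matrix_vector)

lemma sym_matrix_iff_inner: "sym_matrix M \<longleftrightarrow> (\<forall>u v. u \<bullet> (M *v v) = v \<bullet> (M *v u))"
proof
  assume "sym_matrix M"
  then show "\<forall>u v. u \<bullet> (M *v v) = v \<bullet> (M *v u)"
    by (metis inner_commute inner_transpose_right sym_matrix_def)
next
  assume h: "\<forall>u v. u \<bullet> (M *v v) = v \<bullet> (M *v u)"
  have "transpose M *v v = M *v v" for v
  proof (rule vector_eq_ldot[THEN iffD1], rule allI)
    show "u \<bullet> (transpose M *v v) = u \<bullet> (M *v v)" for u
      using h by (simp add: inner_transpose_right inner_commute)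
  qed
  then show "sym_matrix M"
    unfolding sym_matrix_def by (simp add: matrix_eq)
qed

text \<open>The quadratic form is minimal at \<open>x\<close>, so its gradient \<open>2 M x\<close> vanishes there. The proof moves
  from \<open>x\<close> a little against the direction \<open>M x\<close>.\<close>

lemma psd_quadratic_form_zero:
  assumes "sym_matrix M" and psd: "\<And>v. 0 \<le> v \<bullet> (M *v v)" and zero: "x \<bullet> (M *v x) = 0"
  shows "M *v x = 0"
proof (rule ccontr)
  define w where "w = M *v x"
  define d where "d = w \<bullet> (M *v w)"
  assume "M *v x \<noteq> 0"
  then have c: "0 < w \<bullet> w" by (simp add: w_def)
  have d: "0 \<le> d" using psd d_def by simp
  \<comment> \<open>a step for which the linear decrease \<open>2 r (w \<bullet> w)\<close> outweighs the quadratic term \<open>r\<^sup>2 d\<close>\<close>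
  define r where "r = - (w \<bullet> w) / (d + 1)"
  have "x \<bullet> (M *v w) = w \<bullet> w"
    using assms(1) unfolding sym_matrix_iff_inner w_def by metis
  then have "(x + r *\<^sub>R w) \<bullet> (M *v (x + r *\<^sub>R w)) = 2 * r * (w \<bullet> w) + r\<^sup>2 * d"
    using zero
    by (simp add: matrix_vector_right_distrib matrix_vector_mult_scaleR inner_add_left
        inner_add_right d_def w_def[symmetric] power2_eq_square algebra_simps)
  moreover have "w \<bullet> w = - r * (d + 1)" using d by (simp add: r_def)
  then have "2 * r * (w \<bullet> w) + r\<^sup>2 * d = - (r\<^sup>2 * (d + 2))"
    by algebra
  moreover have "r \<noteq> 0" using c d by (simp add: r_def)
  then have "0 < r\<^sup>2 * (d + 2)" using d by simp
  ultimately show False using psd[of "x + r *\<^sub>R w"] by linarith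
qed

lemma matrix_inv_inverse:
  fixes M :: "real^'n^'n"
  assumes "invertible M"
  shows "M ** matrix_inv M = mat 1" "matrix_inv M ** M = mat 1"
  using someI_ex[OF assms[unfolded invertible_def]] by (auto simp: matrix_inv_def)

lemma invertible_mat_1: "invertible (mat 1 :: real^'n^'n)"
  by (simp add: invertible_det_nz)

lemma matrix_inv_mat_1: "matrix_inv (mat 1) = (mat 1 :: real^'n^'n)"
  using matrix_inv_inverse(1)[OF invertible_mat_1] by simp

lemma invertible_if_kernel_trivial:
  fixes M :: "real^'n^'n"
  assumes "\<And>v. M *v v = 0 \<Longrightarrow> v = 0"
  shows "invertible M"
  using assms matrix_left_invertible_ker invertible_left_inverse by blast

lemma tendsto_det [tendsto_intros]:
  fixes X :: "'a \<Rightarrow> real^'n^'n"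
  assumes "(X \<longlongrightarrow> L) F"
  shows "((\<lambda>t. det (X t)) \<longlongrightarrow> det L) F"
  unfolding det_def by (intro tendsto_intros assms)

text \<open>Cramer's rule writes each entry of the inverse as a quotient of determinants, which are
  polynomials in the entries.\<close>

lemma tendsto_matrix_inv:
  fixes X :: "'a \<Rightarrow> real^'n^'n"
  assumes lim: "(X \<longlongrightarrow> L) F" and inv: "invertible L" "\<forall>\<^sub>F t in F. invertible (X t)"
  shows "((\<lambda>t. matrix_inv (X t)) \<longlongrightarrow> matrix_inv L) F"
proof -
  define C :: "real^'n^'n \<Rightarrow> real^'n^'n" where
    "C M = (\<chi> k l. det (\<chi> i j. if j = k then axis l 1 $ i else M $ i $ j) / det M)" for M
  have C: "matrix_inv M = C M" if "invertible M" for M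
  proof -
    have "column l (matrix_inv M) = column l (C M)" for l
    proof -
      have "M *v column l (matrix_inv M) = axis l 1"
        using matrix_inv_inverse(1)[OF that]
        by (metis matrix_vector_mul_assoc matrix_vector_mul_lid matrix_vector_mult_basis)
      then show ?thesis
        using that cramer[of M] by (simp add: invertible_det_nz C_def column_def)
    qed
    then show ?thesis by (simp add: vec_eq_iff column_def)
  qed
  have "((\<lambda>t. C (X t)) \<longlongrightarrow> C L) F"
    unfolding C_def
  proof (intro tendsto_intros lim)
    show "((\<lambda>t. if j = k then axis l 1 $ i else X t $ i $ j)
        \<longlongrightarrow> (if j = k then axis l 1 $ i else L $ i $ j)) F" for i j k l :: 'n
      by (cases "j = k") (auto intro!: tendsto_intros lim)
    show "det L \<noteq> 0" using inv(1) by (simp add: invertible_det_nz)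
  qed
  then show ?thesis
    unfolding C[OF inv(1)]
    by (rule Lim_transform_eventually) (use inv(2) in eventually_elim, simp add: C)
qed

lemma has_vector_derivative_iff_difference_quotient:
  "(f has_vector_derivative D) (at t within S) \<longleftrightarrow>
     ((\<lambda>r. (f r - f t) /\<^sub>R (r - t)) \<longlongrightarrow> D) (at t within S)"
proof -
  have eq: "norm ((1 / norm (r - t)) *\<^sub>R (f r - (f t + (r - t) *\<^sub>R D)))
      = norm ((f r - f t) /\<^sub>R (r - t) - D)" if "r \<noteq> t" for r
  proof -
    have "f r - (f t + (r - t) *\<^sub>R D) = (r - t) *\<^sub>R ((f r - f t) /\<^sub>R (r - t) - D)"
      using that by (simp add: scaleR_diff_right)
    then show ?thesis using that by simp
  qed
  have "(f has_vector_derivative D) (at t within S) \<longleftrightarrow>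
      ((\<lambda>r. norm ((1 / norm (r - t)) *\<^sub>R (f r - (f t + (r - t) *\<^sub>R D)))) \<longlongrightarrow> 0) (at t within S)"
    unfolding has_vector_derivative_def has_derivative_within tendsto_norm_zero_iff
    by (simp add: bounded_linear_scaleR_left)
  also have "\<dots> \<longleftrightarrow> ((\<lambda>r. norm ((f r - f t) /\<^sub>R (r - t) - D)) \<longlongrightarrow> 0) (at t within S)"
  proof (intro filterlim_cong refl)
    show "\<forall>\<^sub>F r in at t within S. norm ((1 / norm (r - t)) *\<^sub>R (f r - (f t + (r - t) *\<^sub>R D)))
        = norm ((f r - f t) /\<^sub>R (r - t) - D)"
      unfolding eventually_at_filter using eq by (intro always_eventually) blast
  qed
  also have "\<dots> \<longleftrightarrow> ((\<lambda>r. (f r - f t) /\<^sub>R (r - t)) \<longlongrightarrow> D) (at t within S)"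
    unfolding tendsto_norm_zero_iff by (rule LIM_zero_iff)
  finally show ?thesis .
qed

text \<open>The identity \<open>X(r)\<^sup>-\<^sup>1 - X(t)\<^sup>-\<^sup>1 = - X(r)\<^sup>-\<^sup>1 (X(r) - X(t)) X(t)\<^sup>-\<^sup>1\<close> turns the difference quotient of
  the inverse into that of \<open>X\<close>; continuity of the inverse then gives the limit.\<close>

lemma has_vector_derivative_matrix_inv:
  fixes X :: "real \<Rightarrow> real^'n^'n"
  assumes der: "(X has_vector_derivative X') (at t within S)"
    and inv: "\<And>r. r \<in> S \<Longrightarrow> invertible (X r)" and "t \<in> S"
  shows "((\<lambda>r. matrix_inv (X r)) has_vector_derivative
           - (matrix_inv (X t) ** X' ** matrix_inv (X t))) (at t within S)"
proof -
  interpret mm: bounded_bilinear "(**) :: real^'n^'n \<Rightarrow> real^'n^'n \<Rightarrow> real^'n^'n"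
    by (rule bounded_bilinear_matrix_matrix_mult)
  let ?Y = "\<lambda>r. matrix_inv (X r)"
  have evS: "\<forall>\<^sub>F r in at t within S. r \<in> S"
    by (simp add: eventually_at_filter)
  have "(X \<longlongrightarrow> X t) (at t within S)"
    using has_vector_derivative_continuous[OF der] by (simp add: continuous_within)
  then have Y: "(?Y \<longlongrightarrow> ?Y t) (at t within S)"
    by (rule tendsto_matrix_inv) (use inv \<open>t \<in> S\<close> evS in \<open>auto elim: eventually_mono\<close>)
  have q: "((\<lambda>r. (X r - X t) /\<^sub>R (r - t)) \<longlongrightarrow> X') (at t within S)"
    using der by (simp add: has_vector_derivative_iff_difference_quotient)
  have "((\<lambda>r. - (?Y r ** ((X r - X t) /\<^sub>R (r - t)) ** ?Y t)) \<longlongrightarrow> - (?Y t ** X' ** ?Y t))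
      (at t within S)"
    by (intro tendsto_intros mm.tendsto Y q)
  moreover have "- (?Y r ** ((X r - X t) /\<^sub>R (r - t)) ** ?Y t) = (?Y r - ?Y t) /\<^sub>R (r - t)"
    if "r \<in> S" for r
  proof -
    have "?Y r ** (X r - X t) ** ?Y t = ?Y t - ?Y r"
      using matrix_inv_inverse[OF inv[OF that]] matrix_inv_inverse[OF inv[OF \<open>t \<in> S\<close>]]
      by (simp add: mm.diff_left mm.diff_right) (simp add: matrix_mul_assoc[symmetric])
    then have "(?Y r ** ((X r - X t) /\<^sub>R (r - t))) ** ?Y t = (?Y t - ?Y r) /\<^sub>R (r - t)"
      by (simp add: mm.scaleR_left mm.scaleR_right)
    then show ?thesis by (simp add: scaleR_diff_right)
  qed
  ultimately have "((\<lambda>r. (?Y r - ?Y t) /\<^sub>R (r - t)) \<longlongrightarrow> - (?Y t ** X' ** ?Y t)) (at t within S)"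
    using Lim_transform_eventually eventually_mono[OF evS] by (metis (mono_tags, lifting))
  then show ?thesis
    by (simp add: has_vector_derivative_iff_difference_quotient)
qed

section \<open>Functions on intervals determined by their derivatives\<close>

lemma antitone_if_derivative_nonpos:
  fixes g :: "real \<Rightarrow> real"
  assumes der: "\<And>t. t \<in> J \<Longrightarrow> (g has_vector_derivative g' t) (at t within J)"
    and nonpos: "\<And>t. t \<in> J \<Longrightarrow> g' t \<le> 0" and sub: "{p..q} \<subseteq> J" and "p \<le> q"
  shows "g q \<le> g p"
proof (cases "p = q")
  case False
  with \<open>p \<le> q\<close> have "p < q" by simp
  then obtain x where "x \<in> {p<..<q}" "g q - g p = (q - p) *\<^sub>R g' x"
    using mvt_simple[of p q g "\<lambda>t h. h *\<^sub>R g' t"] der sub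
    by (metis atLeastAtMost_iff has_derivative_subset has_vector_derivative_def subsetD)
  moreover from this have "x \<in> J" using sub by auto
  then have "g' x \<le> 0" by (rule nonpos)
  ultimately have "g q - g p \<le> 0" using \<open>p < q\<close> by (simp add: mult_nonneg_nonpos)
  then show ?thesis by simp
qed auto

text \<open>The uniqueness part of Gronwall's argument: with \<open>K\<close> an upper bound of \<open>k\<close>, the function
  \<open>exp (-2 K t) |f|\<^sup>2\<close> is nonincreasing and \<open>exp (2 K t) |f|\<^sup>2\<close> is nondecreasing, so a zero
  propagates forwards and backwards in time.\<close>

lemma zero_at_if_derivative_bounded:
  fixes f :: "real \<Rightarrow> 'a::real_inner"
  assumes J: "is_interval J" "p \<in> J" "q \<in> J"
    and der: "\<And>t. t \<in> J \<Longrightarrow> (f has_vector_derivative f' t) (at t within J)"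
    and bound: "\<And>t. t \<in> J \<Longrightarrow> norm (f' t) \<le> k t * norm (f t)"
    and k: "continuous_on J k" and zero: "f p = 0"
  shows "f q = 0"
proof -
  define S where "S = closed_segment p q"
  have SJ: "S \<subseteq> J"
    unfolding S_def using J by (intro closed_segment_subset is_interval_convex)
  have "compact (k ` S)"
    using k SJ by (intro compact_continuous_image) (auto intro: continuous_on_subset simp: S_def)
  then obtain K where K: "\<And>t. t \<in> S \<Longrightarrow> k t \<le> K"
    by (meson bounded_imp_bdd_above bdd_above_def compact_imp_bounded imageI)
  have ff: "\<bar>f t \<bullet> f' t\<bar> \<le> K * (f t \<bullet> f t)" if "t \<in> S" for t
  proof -
    have "\<bar>f t \<bullet> f' t\<bar> \<le> norm (f t) * norm (f' t)" by (rule Cauchy_Schwarz_ineq2)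
    also have "\<dots> \<le> norm (f t) * (K * norm (f t))"
    proof (intro mult_left_mono norm_ge_zero)
      have "t \<in> J" using that SJ by auto
      then have "norm (f' t) \<le> k t * norm (f t)" by (rule bound)
      also have "\<dots> \<le> K * norm (f t)" using K[OF that] by (rule mult_right_mono) simp
      finally show "norm (f' t) \<le> K * norm (f t)" .
    qed
    finally show ?thesis by (simp add: power2_norm_eq_inner[symmetric] power2_eq_square ac_simps)
  qed
  have derg: "((\<lambda>t. exp (c * t) * (f t \<bullet> f t)) has_vector_derivative
      exp (c * t) * (c * (f t \<bullet> f t) + 2 * (f t \<bullet> f' t))) (at t within S)" if "t \<in> S" for c t
  proof -
    have 1: "((\<lambda>t. f t \<bullet> f t) has_vector_derivative (f t \<bullet> f' t + f' t \<bullet> f t)) (at t within S)"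
      using der[of t] that SJ
      by (intro bounded_bilinear.has_vector_derivative[OF bounded_bilinear_inner])
         (auto intro: has_vector_derivative_within_subset)
    have 2: "((\<lambda>t. exp (c * t)) has_vector_derivative (c * exp (c * t))) (at t within S)"
      unfolding has_real_derivative_iff_has_vector_derivative[symmetric]
      by (auto intro!: derivative_eq_intros)
    show ?thesis
      using has_vector_derivative_mult[OF 2 1] by (simp add: algebra_simps inner_commute)
  qed
  have "f q \<bullet> f q \<le> 0"
  proof (cases "p \<le> q")
    case True
    have "exp (-2*K * t) * (-2*K * (f t \<bullet> f t) + 2 * (f t \<bullet> f' t)) \<le> 0" if "t \<in> S" for t
      using ff[OF that] by (intro mult_nonneg_nonpos) auto
    then have "exp (-2*K * q) * (f q \<bullet> f q) \<le> exp (-2*K * p) * (f p \<bullet> f p)"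
      using True by (intro antitone_if_derivative_nonpos[OF derg])
         (auto simp: S_def closed_segment_eq_real_ivl)
    then show ?thesis using zero by (simp add: mult_le_0_iff)
  next
    case False
    have "- (exp (2*K * t) * (2*K * (f t \<bullet> f t) + 2 * (f t \<bullet> f' t))) \<le> 0" if "t \<in> S" for t
    proof -
      have "0 \<le> 2*K * (f t \<bullet> f t) + 2 * (f t \<bullet> f' t)" using ff[OF that] by linarith
      then show ?thesis by simp
    qed
    then have "- (exp (2*K * p) * (f p \<bullet> f p)) \<le> - (exp (2*K * q) * (f q \<bullet> f q))"
      using False by (intro antitone_if_derivative_nonpos[OF has_vector_derivative_minus[OF derg]])
         (auto simp: S_def closed_segment_eq_real_ivl)
    then show ?thesis using zero by (simp add: mult_le_0_iff)
  qed
  then show ?thesis by (metis inner_eq_zero_iff inner_ge_zero order_antisym)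
qed

text \<open>Proved on the closed interval, endpoints included, so that identities between derivatives
  along a trajectory are available at both ends.\<close>

lemma derivative_zero_if_constant:
  assumes "a < b" "t \<in> {a..b}" "\<And>r. r \<in> {a..b} \<Longrightarrow> f r = c"
    and der: "(f has_vector_derivative f') (at t within {a..b})"
  shows "f' = 0"
proof -
  have "((\<lambda>_. c) has_vector_derivative f') (at t within {a..b})"
    using has_vector_derivative_transform[OF assms(2) _ der] assms(3) by metis
  then show ?thesis
    using vector_derivative_unique_within_closed_interval[of a b t "\<lambda>_. c" f' 0] assms(1,2)
    by auto
qed

lemma linear_ode_solution_zero:
  fixes f :: "real \<Rightarrow> real^'m" and L :: "real \<Rightarrow> real^'m^'m"
  assumes J: "is_interval J" "p \<in> J" "q \<in> J"
    and der: "\<And>t. t \<in> J \<Longrightarrow> (f has_vector_derivative L t *v f t) (at t within J)"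
    and L: "continuous_on J L" and zero: "f p = 0"
  shows "f q = 0"
proof -
  obtain C where C: "\<And>(M :: real^'m^'m) v. norm (M *v v) \<le> norm M * norm v * C"
    using bounded_bilinear.bounded[OF bounded_bilinear_matrix_vector_mult] by blast
  show ?thesis
  proof (rule zero_at_if_derivative_bounded[where f = f and k = "\<lambda>t. C * norm (L t)"])
    show "norm (L t *v f t) \<le> C * norm (L t) * norm (f t)" for t
      using C[of "L t" "f t"] by (simp add: ac_simps)
    show "continuous_on J (\<lambda>t. C * norm (L t))"
      by (intro continuous_intros L)
  qed (use J der zero in auto)
qed

section \<open>Total controllability forces unobserved costates to vanish\<close>

lemma times_cont_diff_SucD: "times_cont_diff (Suc k) f \<Longrightarrow> times_cont_diff k f"
proof (induction k arbitrary: f)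
  case 0
  then show ?case
    by (auto simp: continuous_on_eq_continuous_at intro: differentiable_imp_continuous_within)
next
  case (Suc k)
  from Suc.prems have "times_cont_diff (Suc k) (\<lambda>t. vector_derivative f (at t))"
    unfolding times_cont_diff.simps(2)[of "Suc k"] by blast
  then have "times_cont_diff k (\<lambda>t. vector_derivative f (at t))" by (rule Suc.IH)
  with Suc.prems show ?case by simp
qed

lemma times_cont_diff_mono: "times_cont_diff m f \<Longrightarrow> k \<le> m \<Longrightarrow> times_cont_diff k f"
  by (induction m) (auto simp: le_Suc_eq dest: times_cont_diff_SucD simp del: times_cont_diff.simps)

lemma times_cont_diff_imp_continuous: "times_cont_diff k f \<Longrightarrow> continuous_on UNIV f"
  using times_cont_diff_mono[of k f 0] by simp

lemma times_cont_diff_add: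
  "times_cont_diff k f \<Longrightarrow> times_cont_diff k g \<Longrightarrow> times_cont_diff k (\<lambda>t. f t + g t)"
proof (induction k arbitrary: f g)
  case (Suc k)
  then have "vector_derivative (\<lambda>t. f t + g t) (at t)
      = vector_derivative f (at t) + vector_derivative g (at t)" for t
    by (intro vector_derivative_at has_vector_derivative_add)
       (auto simp: vector_derivative_works[symmetric])
  with Suc show ?case by simp
qed (auto intro: continuous_intros)

lemma times_cont_diff_bilinear:
  assumes "bounded_bilinear h"
  shows "times_cont_diff k f \<Longrightarrow> times_cont_diff k g \<Longrightarrow> times_cont_diff k (\<lambda>t. h (f t) (g t))"
proof (induction k arbitrary: f g)
  case 0
  then show ?case by (auto intro: bounded_bilinear.continuous_on[OF assms])
next
  case (Suc k)
  have der: "((\<lambda>t. h (f t) (g t)) has_vector_derivative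
      h (f t) (vector_derivative g (at t)) + h (vector_derivative f (at t)) (g t)) (at t)" for t
    using Suc.prems by (intro bounded_bilinear.has_vector_derivative[OF assms])
       (auto simp: vector_derivative_works[symmetric])
  have "times_cont_diff k (\<lambda>t. h (f t) (vector_derivative g (at t))
      + h (vector_derivative f (at t)) (g t))"
    using Suc.prems times_cont_diff_SucD[OF Suc.prems(1)] times_cont_diff_SucD[OF Suc.prems(2)]
    by (intro times_cont_diff_add Suc.IH) simp_all
  moreover have "(\<lambda>t. h (f t) (g t)) differentiable (at t)" for t
    using der by (rule differentiableI_vector)
  moreover note vector_derivative_at[OF der]
  ultimately show ?case by simp
qed

text \<open>Each step of the recursion costs one derivative of \<open>\<Gamma>\<^sub>k\<close>, so that starting from \<open>m\<close>
  derivatives of \<open>B\<close>, the matrices \<open>\<Gamma>\<^sub>0, ..., \<Gamma>\<^sub>m\<^sub>-\<^sub>1\<close> are differentiable.\<close>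

lemma times_cont_diff_ctrb_Gamma:
  fixes A :: "real \<Rightarrow> real^'n^'n" and B :: "real \<Rightarrow> real^'p^'n"
  assumes A: "times_cont_diff (m - 1) A" and B: "times_cont_diff m B"
  shows "k \<le> m \<Longrightarrow> times_cont_diff (m - k) (ctrb_Gamma A B k)"
proof (induction k)
  case (Suc k)
  have bb: "bounded_bilinear (\<lambda>(X :: real^'n^'n) (Y :: real^'p^'n). - (X ** Y))"
    using bounded_bilinear_matrix_matrix_mult
    unfolding bilinear_conv_bounded_bilinear[symmetric] bilinear_def
    by (auto intro: linear_compose_neg)
  have G: "times_cont_diff (Suc (m - Suc k)) (ctrb_Gamma A B k)"
    using Suc by (simp add: Suc_diff_Suc del: times_cont_diff.simps)
  moreover have "times_cont_diff (m - Suc k) A"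
    using A by (rule times_cont_diff_mono) simp
  ultimately have "times_cont_diff (m - Suc k)
      (\<lambda>t. - (A t ** ctrb_Gamma A B k t) + vector_derivative (ctrb_Gamma A B k) (at t))"
    using times_cont_diff_SucD[OF G]
    by (intro times_cont_diff_add times_cont_diff_bilinear[OF bb]) simp_all
  then show ?case by simp
qed (simp add: B)

text \<open>The hypothesis says that \<open>v\<close> is orthogonal to all columns of \<open>\<Theta>\<close>, and these span the space.\<close>

lemma ctrb_Theta_orthogonal_zero:
  assumes rank: "rank (ctrb_Theta A B t) = CARD('n)"
    and orth: "\<And>k. k < CARD('n) \<Longrightarrow> transpose (ctrb_Gamma A B k t) *v v = 0"
  shows "(v :: real^'n) = 0"
proof -
  have "rank (transpose (ctrb_Theta A B t)) = CARD('n)" using rank by (simp add: rank_transpose)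
  then have inj: "inj ((*v) (transpose (ctrb_Theta A B t)))" by (simp add: full_rank_injective)
  have "(transpose (ctrb_Theta A B t) *v v) $ kj = 0" for kj
  proof -
    have "to_nat_on (UNIV :: 'n set) (fst kj) < CARD('n)"
      using to_nat_on_finite[of "UNIV :: 'n set"] bij_betwE by fastforce
    from orth[OF this] have "(transpose (ctrb_Gamma A B (to_nat_on UNIV (fst kj)) t) *v v) $ snd kj = 0"
      by simp
    then show ?thesis
      by (simp add: ctrb_Theta_def matrix_vector_mult_def transpose_def)
  qed
  then have "transpose (ctrb_Theta A B t) *v v = transpose (ctrb_Theta A B t) *v 0"
    by (simp add: vec_eq_iff)
  with inj show ?thesis by (rule injD)
qed

text \<open>Along \<open>y' = - A\<^sup>T y\<close> one has \<open>(\<Gamma>\<^sub>k\<^sup>T y)' = \<Gamma>\<^sub>k\<^sub>+\<^sub>1\<^sup>T y\<close>, so \<open>B\<^sup>T y = 0\<close> implies \<open>\<Gamma>\<^sub>k\<^sup>T y = 0\<close> for all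
  \<open>k < n\<close>. At a time where \<open>\<Theta>\<close> has full rank this means \<open>y = 0\<close>, and uniqueness carries the
  zero back to \<open>a\<close>.\<close>

lemma unobserved_costate_zero:
  fixes A :: "real \<Rightarrow> real^'n^'n" and B :: "real \<Rightarrow> real^'p^'n"
  assumes A: "times_cont_diff (CARD('n) - 1) A" and B: "times_cont_diff (CARD('n)) B"
    and ctrb: "totally_controllable A B" and "a < b"
    and der: "\<And>t. t \<in> {a..b} \<Longrightarrow>
      (y has_vector_derivative - (transpose (A t) *v y t)) (at t within {a..b})"
    and unobserved: "\<And>t. t \<in> {a..b} \<Longrightarrow> transpose (B t) *v y t = 0"
  shows "y a = 0"
proof -
  have Gamma: "transpose (ctrb_Gamma A B k t) *v y t = 0" if "k < CARD('n)" "t \<in> {a..b}" for k t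
    using that
  proof (induction k arbitrary: t)
    case 0
    then show ?case by (simp add: unobserved)
  next
    case (Suc k)
    let ?G = "ctrb_Gamma A B k" and ?G' = "vector_derivative (ctrb_Gamma A B k) (at t)"
    have "CARD('n) - k = Suc (CARD('n) - Suc k)" using Suc.prems by simp
    then have "?G differentiable (at t)"
      using times_cont_diff_ctrb_Gamma[OF A B, of k] Suc.prems by simp
    then have "(?G has_vector_derivative ?G') (at t within {a..b})"
      by (meson has_vector_derivative_at_within vector_derivative_works)
    then have "((\<lambda>r. transpose (?G r) *v y r) has_vector_derivative
        transpose (?G t) *v (- (transpose (A t) *v y t)) + transpose ?G' *v y t) (at t within {a..b})"
      using Suc.prems
      by (intro bounded_bilinear.has_vector_derivative[OF bounded_bilinear_matrix_vector_mult] der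
          bounded_linear.has_vector_derivative[OF bounded_linear_transpose])
    moreover have "transpose (?G r) *v y r = 0" if "r \<in> {a..b}" for r
      using Suc.IH[OF _ that] Suc.prems by simp
    ultimately have "transpose (?G t) *v (- (transpose (A t) *v y t)) + transpose ?G' *v y t = 0"
      by (rule derivative_zero_if_constant[OF \<open>a < b\<close> Suc.prems(2), rotated])
    moreover have "transpose (ctrb_Gamma A B (Suc k) t)
        = - (transpose (?G t) ** transpose (A t)) + transpose ?G'"
    proof -
      have "linear (transpose :: real^'p^'n \<Rightarrow> real^'n^'p)"
        using bounded_linear_transpose by (rule bounded_linear.linear)
      from linear_add[OF this] linear_neg[OF this] show ?thesis
        by (simp only: ctrb_Gamma.simps(2) matrix_transpose_mul)
    qed
    ultimately show ?case
      by (simp add: matrix_vector_mult_simps matrix_vector_mul_assoc)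
  qed
  obtain t where t: "t \<in> {a<..<b}" "rank (ctrb_Theta A B t) = CARD('n)"
    using ctrb \<open>a < b\<close> unfolding totally_controllable_def by blast
  then have "y t = 0"
    using Gamma by (intro ctrb_Theta_orthogonal_zero[OF t(2)]) auto
  show ?thesis
  proof (rule linear_ode_solution_zero[where J = "{a..b}" and p = t and L = "\<lambda>t. - transpose (A t)"])
    show "(y has_vector_derivative - transpose (A t) *v y t) (at t within {a..b})"
      if "t \<in> {a..b}" for t
      using der[OF that] by (simp add: matrix_vector_mult_simps)
    show "continuous_on {a..b} (\<lambda>t. - transpose (A t))"
      using times_cont_diff_imp_continuous[OF A]
      by (auto intro!: continuous_intros intro: continuous_on_subset)
  qed (use t \<open>y t = 0\<close> \<open>a < b\<close> in \<open>auto simp: is_interval_cc\<close>)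
qed

section \<open>The Hamiltonian system and its trajectories\<close>

text \<open>The entries may be numbers or rows of a matrix, so the same functions split vectors of length
  \<open>2n\<close> and matrices with \<open>2n\<close> rows into halves.\<close>

definition stack_rows :: "'a^'n \<Rightarrow> 'a^'n \<Rightarrow> 'a^('n + 'n)" where
  "stack_rows x y = (\<chi> i. case i of Inl k \<Rightarrow> x $ k | Inr k \<Rightarrow> y $ k)"

definition upper_rows :: "'a^('n + 'n) \<Rightarrow> 'a^'n" where
  "upper_rows z = (\<chi> i. z $ Inl i)"

definition lower_rows :: "'a^('n + 'n) \<Rightarrow> 'a^'n" where
  "lower_rows z = (\<chi> i. z $ Inr i)"

lemma rows_stack_rows [simp]:
  "upper_rows (stack_rows x y) = x" "lower_rows (stack_rows x y) = y"
  by (simp_all add: vec_eq_iff upper_rows_def lower_rows_def stack_rows_def)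

lemma sum_UNIV_sum_type:
  fixes f :: "'a::finite + 'b::finite \<Rightarrow> 'c::comm_monoid_add"
  shows "(\<Sum>i\<in>UNIV. f i) = (\<Sum>i\<in>UNIV. f (Inl i)) + (\<Sum>i\<in>UNIV. f (Inr i))"
  unfolding UNIV_Plus_UNIV[symmetric] by (subst sum.Plus) (simp_all add: comp_def)

lemma bounded_linear_upper_rows:
    "bounded_linear (upper_rows :: 'a::euclidean_space^('n + 'n) \<Rightarrow> 'a^'n)"
  and bounded_linear_lower_rows:
    "bounded_linear (lower_rows :: 'a::euclidean_space^('n + 'n) \<Rightarrow> 'a^'n)"
  unfolding linear_conv_bounded_linear[symmetric] linear_iff
  by (simp_all add: vec_eq_iff upper_rows_def lower_rows_def)

lemma bounded_linear_stack_rows: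
  "bounded_linear (\<lambda>p. stack_rows (fst p) (snd p) :: 'a::euclidean_space^('n::finite + 'n))"
  unfolding linear_conv_bounded_linear[symmetric] linear_iff
  by (auto simp: vec_eq_iff stack_rows_def split: sum.split)

lemma hamiltonian_mult_stack_rows:
  fixes x y :: "real^'n"
  shows "hamiltonian A B Q t *v stack_rows x y = stack_rows
     (A t *v x - B t *v (transpose (B t) *v y)) (- (Q t *v x) - transpose (A t) *v y)"
    (is "?l = ?r")
proof -
  have "?l $ i = ?r $ i" for i
    unfolding matrix_vector_mul_assoc
    by (cases i) (simp_all add: hamiltonian_def block_matrix_def stack_rows_def
        matrix_vector_mult_def sum_UNIV_sum_type sum_negf)
  then show ?thesis by (simp add: vec_eq_iff)
qed

lemma rows_hamiltonian_mult:
  fixes Z :: "real^'q^('n::finite + 'n)"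
  shows "upper_rows (hamiltonian A B Q t ** Z)
      = A t ** upper_rows Z - B t ** transpose (B t) ** lower_rows Z"
    and "lower_rows (hamiltonian A B Q t ** Z)
      = - (Q t ** upper_rows Z) - transpose (A t) ** lower_rows Z"
  by (simp_all add: vec_eq_iff hamiltonian_def block_matrix_def upper_rows_def lower_rows_def
      matrix_matrix_mult_def[of _ Z] matrix_matrix_mult_def[of _ "\<chi> i. Z $ _ i"]
      sum_UNIV_sum_type sum_negf)

lemma upper_rows_mult_stack_rows:
  fixes C D :: "real^'q^'n"
  shows "upper_rows (Z ** stack_rows C D) = block11 Z ** C + block12 Z ** D"
  by (simp add: vec_eq_iff upper_rows_def stack_rows_def block11_def block12_def
      matrix_matrix_mult_def sum_UNIV_sum_type)

lemma continuous_on_hamiltonian: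
  assumes "continuous_on T A" "continuous_on T B" "continuous_on T Q"
  shows "continuous_on T (hamiltonian A B Q)"
proof -
  have G: "continuous_on T (\<lambda>t. - (B t ** transpose (B t)))"
      "continuous_on T (\<lambda>t. - transpose (A t))" "continuous_on T (\<lambda>t. - Q t)"
    by (intro continuous_intros assms)+
  have "continuous_on T (\<lambda>t. hamiltonian A B Q t $ i $ j)" for i j
    by (cases i; cases j)
       (simp_all add: hamiltonian_def block_matrix_def assms G continuous_on_component
         del: uminus_vec_def vector_uminus_component)
  then have "continuous_on T (\<lambda>t. \<chi> i j. hamiltonian A B Q t $ i $ j)"
    by (intro continuous_on_vec_lambda)
  then show ?thesis by (simp add: vec_lambda_eta)
qed

locale hamiltonian_system =
  fixes A Q :: "real \<Rightarrow> real^'n^'n" and B :: "real \<Rightarrow> real^'p^'n"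
  assumes cont: "continuous_on UNIV A" "continuous_on UNIV B" "continuous_on UNIV Q"
    and Q_sym: "\<And>t. sym_matrix (Q t)" and Q_psd: "\<And>t v. 0 \<le> v \<bullet> (Q t *v v)"
begin

definition trajectory :: "(real \<Rightarrow> real^'n) \<Rightarrow> (real \<Rightarrow> real^'n) \<Rightarrow> bool" where
  "trajectory x y \<longleftrightarrow> (\<forall>t.
     (x has_vector_derivative A t *v x t - B t *v (transpose (B t) *v y t)) (at t) \<and>
     (y has_vector_derivative - (Q t *v x t) - transpose (A t) *v y t) (at t))"

lemma trajectory_diff:
  assumes "trajectory x1 y1" "trajectory x2 y2"
  shows "trajectory (\<lambda>t. x1 t - x2 t) (\<lambda>t. y1 t - y2 t)"
  unfolding trajectory_def
proof (intro allI conjI)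
  fix t
  note d = assms[unfolded trajectory_def, rule_format, of t]
  show "((\<lambda>t. x1 t - x2 t) has_vector_derivative
      A t *v (x1 t - x2 t) - B t *v (transpose (B t) *v (y1 t - y2 t))) (at t)"
    using has_vector_derivative_diff[OF d(1)[THEN conjunct1] d(2)[THEN conjunct1]]
    by (simp add: matrix_vector_mult_simps algebra_simps)
  show "((\<lambda>t. y1 t - y2 t) has_vector_derivative
      - (Q t *v (x1 t - x2 t)) - transpose (A t) *v (y1 t - y2 t)) (at t)"
    using has_vector_derivative_diff[OF d(1)[THEN conjunct2] d(2)[THEN conjunct2]]
    by (simp add: matrix_vector_mult_simps algebra_simps)
qed

lemma trajectory_zero:
  assumes "trajectory x y" and zero: "x p = 0" "y p = 0"
  shows "x q = 0" "y q = 0"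
proof -
  let ?z = "\<lambda>t. stack_rows (x t) (y t)"
  have "?z q = 0"
  proof (rule linear_ode_solution_zero[where J = UNIV and f = ?z and L = "hamiltonian A B Q"])
    fix t
    have "((\<lambda>t. (x t, y t)) has_vector_derivative
        (A t *v x t - B t *v (transpose (B t) *v y t), - (Q t *v x t) - transpose (A t) *v y t)) (at t)"
      using assms(1) unfolding trajectory_def by (intro has_vector_derivative_Pair) auto
    from bounded_linear.has_vector_derivative[OF bounded_linear_stack_rows this]
    show "(?z has_vector_derivative hamiltonian A B Q t *v ?z t) (at t)"
      by (simp add: hamiltonian_mult_stack_rows)
    show "continuous_on UNIV (hamiltonian A B Q)"
      by (intro continuous_on_hamiltonian cont)
    show "stack_rows (x p) (y p) = 0"
      using zero by (simp add: vec_eq_iff stack_rows_def split: sum.split)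
  qed auto
  then have "upper_rows (?z q) = 0 \<and> lower_rows (?z q) = 0"
    by (simp add: vec_eq_iff upper_rows_def lower_rows_def del: rows_stack_rows)
  then show "x q = 0" "y q = 0" by auto
qed

text \<open>The Hamiltonian flow preserves the standard symplectic form because \<open>Q\<close> and \<open>B B\<^sup>T\<close> are
  symmetric. All symmetry statements below come from this conservation law.\<close>

lemma wronskian_constant:
  assumes "trajectory x1 y1" "trajectory x2 y2"
  shows "x1 p \<bullet> y2 p - x2 p \<bullet> y1 p = x1 q \<bullet> y2 q - x2 q \<bullet> y1 q"
proof -
  have sym: "x2 t \<bullet> (Q t *v x1 t) = x1 t \<bullet> (Q t *v x2 t)" for t
    using Q_sym sym_matrix_iff_inner by blast
  have "((\<lambda>t. x1 t \<bullet> y2 t - x2 t \<bullet> y1 t) has_vector_derivative 0) (at t)" for t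
  proof -
    note d = assms[unfolded trajectory_def, rule_format, of t]
    have "((\<lambda>t. x1 t \<bullet> y2 t - x2 t \<bullet> y1 t) has_vector_derivative
        (x1 t \<bullet> (- (Q t *v x2 t) - transpose (A t) *v y2 t)
          + (A t *v x1 t - B t *v (transpose (B t) *v y1 t)) \<bullet> y2 t)
      - (x2 t \<bullet> (- (Q t *v x1 t) - transpose (A t) *v y1 t)
          + (A t *v x2 t - B t *v (transpose (B t) *v y2 t)) \<bullet> y1 t)) (at t)"
      using d by (intro has_vector_derivative_diff
          bounded_bilinear.has_vector_derivative[OF bounded_bilinear_inner]) auto
    moreover have "y2 t \<bullet> (B t *v (transpose (B t) *v y1 t))
        = y1 t \<bullet> (B t *v (transpose (B t) *v y2 t))"
    proof -
      have "u \<bullet> (B t *v (transpose (B t) *v v)) = (transpose (B t) *v u) \<bullet> (transpose (B t) *v v)"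
        for u v
        using inner_transpose_right[of "transpose (B t) *v v" "B t" u] by (simp add: inner_commute)
      then show ?thesis by (simp only: inner_commute)
    qed
    ultimately show ?thesis
      by (simp add: inner_diff_left inner_diff_right sym inner_transpose_right[symmetric])
  qed
  then obtain c where "\<And>t. t \<in> UNIV \<Longrightarrow> x1 t \<bullet> y2 t - x2 t \<bullet> y1 t = c"
    by (rule has_vector_derivative_zero_constant[OF convex_UNIV]) blast
  then show ?thesis by simp
qed

lemma energy_derivative:
  assumes "trajectory x y"
  shows "((\<lambda>t. x t \<bullet> y t) has_vector_derivative
    - (x t \<bullet> (Q t *v x t)) - (transpose (B t) *v y t) \<bullet> (transpose (B t) *v y t)) (at t)"
proof -
  have "((\<lambda>t. x t \<bullet> y t) has_vector_derivative
      x t \<bullet> (- (Q t *v x t) - transpose (A t) *v y t)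
        + (A t *v x t - B t *v (transpose (B t) *v y t)) \<bullet> y t) (at t)"
    using assms unfolding trajectory_def
    by (intro bounded_bilinear.has_vector_derivative[OF bounded_bilinear_inner]) auto
  then show ?thesis
    by (simp add: inner_diff_left inner_diff_right inner_transpose_right[symmetric])
qed

text \<open>Along a trajectory, \<open>x \<bullet> y\<close> decreases at the rate of the running cost
  \<open>|B\<^sup>T y|\<^sup>2 + x \<bullet> Q x\<close> of the control \<open>u = - B\<^sup>T y\<close>.\<close>

lemma energy_antitone:
  assumes "trajectory x y" "p \<le> q"
  shows "x q \<bullet> y q \<le> x p \<bullet> y p"
proof (rule antitone_if_derivative_nonpos[where J = UNIV, OF energy_derivative[OF assms(1)]])
  show "- (x t \<bullet> (Q t *v x t)) - (transpose (B t) *v y t) \<bullet> (transpose (B t) *v y t) \<le> 0" for t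
    using Q_psd[where t = t and v = "x t"] inner_ge_zero[of "transpose (B t) *v y t"] by linarith
qed (use assms(2) in auto)

text \<open>Vanishing of the state at both ends forces the running cost between them to vanish, hence
  \<open>B\<^sup>T y = 0\<close> and \<open>Q x = 0\<close>; the costate then solves \<open>y' = - A\<^sup>T y\<close> unobserved by \<open>B\<^sup>T\<close>.\<close>

lemma trajectory_between_zeros_trivial:
  assumes traj: "trajectory x y" and "a < b" and zero: "x a = 0" "x b = 0"
    and A: "times_cont_diff (CARD('n) - 1) A" and B: "times_cont_diff (CARD('n)) B"
    and ctrb: "totally_controllable A B"
  shows "y a = 0"
proof -
  have e0: "x t \<bullet> y t = 0" if "t \<in> {a..b}" for t
    using energy_antitone[OF traj, of a t] energy_antitone[OF traj, of t b] that zero by simp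
  have B0: "transpose (B t) *v y t = 0" and Q0: "Q t *v x t = 0" if t: "t \<in> {a..b}" for t
  proof -
    have "- (x t \<bullet> (Q t *v x t)) - (transpose (B t) *v y t) \<bullet> (transpose (B t) *v y t) = 0"
      using \<open>a < b\<close> t e0 has_vector_derivative_at_within[OF energy_derivative[OF traj]]
      by (rule derivative_zero_if_constant)
    then have "(transpose (B t) *v y t) \<bullet> (transpose (B t) *v y t) = 0" "x t \<bullet> (Q t *v x t) = 0"
      using Q_psd[where t = t and v = "x t"] inner_ge_zero[of "transpose (B t) *v y t"] by linarith+
    then show "transpose (B t) *v y t = 0" "Q t *v x t = 0"
      using psd_quadratic_form_zero[OF Q_sym Q_psd] by auto
  qed
  have "(y has_vector_derivative - (transpose (A t) *v y t)) (at t within {a..b})"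
    if "t \<in> {a..b}" for t
    using traj Q0[OF that] unfolding trajectory_def
    by (metis diff_0 has_vector_derivative_at_within minus_zero)
  then show ?thesis
    using B0 by (rule unobserved_costate_zero[OF A B ctrb \<open>a < b\<close>])
qed

subsection \<open>Matrix trajectories and the transition matrix\<close>

definition matrix_trajectory :: "(real \<Rightarrow> real^'q^'n) \<Rightarrow> (real \<Rightarrow> real^'q^'n) \<Rightarrow> bool" where
  "matrix_trajectory X Y \<longleftrightarrow> (\<forall>t.
     (X has_vector_derivative A t ** X t - B t ** transpose (B t) ** Y t) (at t) \<and>
     (Y has_vector_derivative - (Q t ** X t) - transpose (A t) ** Y t) (at t))"

lemma matrix_trajectory_mult_vector:
  fixes X Y :: "real \<Rightarrow> real^'q^'n"
  assumes "matrix_trajectory X Y"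
  shows "trajectory (\<lambda>t. X t *v v) (\<lambda>t. Y t *v v)"
  unfolding trajectory_def
proof (intro allI conjI)
  fix t
  note d = assms[unfolded matrix_trajectory_def, rule_format, of t]
  have lin: "bounded_linear (\<lambda>M :: real^'q^'n. M *v v)"
    by (rule bounded_bilinear.bounded_linear_left[OF bounded_bilinear_matrix_vector_mult])
  from bounded_linear.has_vector_derivative[OF lin d[THEN conjunct1]]
  show "((\<lambda>t. X t *v v) has_vector_derivative
      A t *v (X t *v v) - B t *v (transpose (B t) *v (Y t *v v))) (at t)"
    by (simp add: matrix_vector_mult_simps matrix_vector_mul_assoc matrix_mul_assoc)
  from bounded_linear.has_vector_derivative[OF lin d[THEN conjunct2]]
  show "((\<lambda>t. Y t *v v) has_vector_derivative
      - (Q t *v (X t *v v)) - transpose (A t) *v (Y t *v v)) (at t)"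
    by (simp add: matrix_vector_mult_simps matrix_vector_mul_assoc)
qed

lemma matrix_trajectory_of_transition:
  fixes C D :: "real^'q^'n"
  assumes "state_transition_matrix (hamiltonian A B Q) \<Phi>"
  obtains Y where
    "matrix_trajectory (\<lambda>t. block11 (\<Phi> t s) ** C + block12 (\<Phi> t s) ** D) Y" "Y s = D"
proof
  let ?Z = "\<lambda>t. \<Phi> t s ** stack_rows C D"
  have Z: "(?Z has_vector_derivative hamiltonian A B Q t ** ?Z t) (at t)" for t
  proof -
    have "((\<lambda>t. \<Phi> t s) has_vector_derivative hamiltonian A B Q t ** \<Phi> t s) (at t)"
      using assms unfolding state_transition_matrix_def by blast
    from bounded_linear.has_vector_derivative[OF
        bounded_bilinear.bounded_linear_left[OF bounded_bilinear_matrix_matrix_mult] this]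
    show ?thesis by (simp add: matrix_mul_assoc)
  qed
  have "((\<lambda>t. upper_rows (?Z t)) has_vector_derivative
      A t ** upper_rows (?Z t) - B t ** transpose (B t) ** lower_rows (?Z t)) (at t)"
    "((\<lambda>t. lower_rows (?Z t)) has_vector_derivative
      - (Q t ** upper_rows (?Z t)) - transpose (A t) ** lower_rows (?Z t)) (at t)" for t
    using bounded_linear.has_vector_derivative[OF bounded_linear_upper_rows Z]
      bounded_linear.has_vector_derivative[OF bounded_linear_lower_rows Z]
    by (simp_all only: rows_hamiltonian_mult)
  then show "matrix_trajectory (\<lambda>t. block11 (\<Phi> t s) ** C + block12 (\<Phi> t s) ** D)
      (\<lambda>t. lower_rows (?Z t))"
    unfolding matrix_trajectory_def upper_rows_mult_stack_rows by blast
  have "\<Phi> s s = mat 1" using assms unfolding state_transition_matrix_def by blast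
  then show "lower_rows (?Z s) = D" by simp
qed

lemma transition_blocks_initial:
  assumes "state_transition_matrix (hamiltonian A B Q) \<Phi>"
  shows "block11 (\<Phi> s s) = mat 1" "block12 (\<Phi> s s) = 0"
proof -
  have "\<Phi> s s = mat 1" using assms unfolding state_transition_matrix_def by blast
  then show "block11 (\<Phi> s s) = mat 1" "block12 (\<Phi> s s) = 0"
    by (simp_all add: block11_def block12_def mat_def vec_eq_iff)
qed

text \<open>A kernel vector of \<open>\<Phi>\<^sub>1\<^sub>2(t,s)\<close> is the initial costate of a trajectory whose state vanishes at
  both \<open>s\<close> and \<open>t\<close>.\<close>

lemma transition_block12_invertible:
  assumes \<Phi>: "state_transition_matrix (hamiltonian A B Q) \<Phi>"
    and A: "times_cont_diff (CARD('n) - 1) A" and B: "times_cont_diff (CARD('n)) B"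
    and ctrb: "totally_controllable A B" and "t \<noteq> s"
  shows "invertible (block12 (\<Phi> t s))"
proof (rule invertible_if_kernel_trivial)
  fix v assume v: "block12 (\<Phi> t s) *v v = 0"
  obtain Y where Y: "Y s = mat 1"
    "matrix_trajectory (\<lambda>t. block11 (\<Phi> t s) ** 0 + block12 (\<Phi> t s) ** mat 1) Y"
    by (rule matrix_trajectory_of_transition[OF \<Phi>])
  then have traj: "trajectory (\<lambda>t. block12 (\<Phi> t s) *v v) (\<lambda>t. Y t *v v)"
    using matrix_trajectory_mult_vector[OF Y(2)] by simp
  have zs: "block12 (\<Phi> s s) *v v = 0" by (simp add: transition_blocks_initial[OF \<Phi>])
  note between = trajectory_between_zeros_trivial[OF traj _ _ _ A B ctrb]
  show "v = 0"
  proof (cases "s < t")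
    case True
    then have "Y s *v v = 0" using between zs v by blast
    then show ?thesis by (simp add: Y)
  next
    case False
    then have "Y t *v v = 0" using between[of t s] zs v \<open>t \<noteq> s\<close> by simp
    then have "Y s *v v = 0" using trajectory_zero(2)[OF traj v] by blast
    then show ?thesis by (simp add: Y)
  qed
qed

subsection \<open>Riccati solutions as quotients of trajectories\<close>

definition riccati_solution_on :: "real set \<Rightarrow> (real \<Rightarrow> real^'n^'n) \<Rightarrow> bool" where
  "riccati_solution_on J P \<longleftrightarrow>
     (\<forall>t\<in>J. (P has_vector_derivative riccati_rhs A B Q t (P t)) (at t within J))"

lemma riccati_solution_continuous: "riccati_solution_on J P \<Longrightarrow> continuous_on J P"
  unfolding riccati_solution_on_def continuous_on_eq_continuous_within
  by (blast intro: has_vector_derivative_continuous)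

lemma cont_on: "continuous_on J A" "continuous_on J B" "continuous_on J Q"
  using cont by (auto intro: continuous_on_subset)

text \<open>Relative to a Riccati solution \<open>P\<close>, the defect \<open>y - P x\<close> of any trajectory satisfies a
  homogeneous linear equation of its own. This yields both the invariance of the graph
  \<open>y = P x\<close> and the completion of the square below.\<close>

lemma riccati_defect_derivative:
  assumes "riccati_solution_on J P" "trajectory x y" "t \<in> J"
  shows "((\<lambda>t. y t - P t *v x t) has_vector_derivative
    (P t ** B t ** transpose (B t) - transpose (A t)) *v (y t - P t *v x t)) (at t within J)"
proof -
  note d = assms(2)[unfolded trajectory_def, rule_format, of t]
  have "((\<lambda>t. y t - P t *v x t) has_vector_derivative
      - (Q t *v x t) - transpose (A t) *v y t
        - (P t *v (A t *v x t - B t *v (transpose (B t) *v y t))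
          + riccati_rhs A B Q t (P t) *v x t)) (at t within J)"
    using assms(1,3) d unfolding riccati_solution_on_def
    by (intro has_vector_derivative_diff
        bounded_bilinear.has_vector_derivative[OF bounded_bilinear_matrix_vector_mult])
       (auto intro: has_vector_derivative_at_within)
  then show ?thesis
    by (simp add: riccati_rhs_def matrix_vector_mult_simps matrix_mult_simps
        matrix_vector_mul_assoc matrix_mul_assoc algebra_simps)
qed

lemma riccati_solution_graph:
  assumes P: "riccati_solution_on J P" and traj: "trajectory x y"
    and J: "is_interval J" "s \<in> J" "t \<in> J" and "y s = P s *v x s"
  shows "y t = P t *v x t"
proof -
  have "y t - P t *v x t = 0"
  proof (rule linear_ode_solution_zero[OF J, where f = "\<lambda>t. y t - P t *v x t"])
    show "continuous_on J (\<lambda>t. P t ** B t ** transpose (B t) - transpose (A t))"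
      by (intro continuous_intros riccati_solution_continuous[OF P] cont_on)
  qed (use riccati_defect_derivative[OF P traj] assms(6) in auto)
  then show ?thesis by simp
qed

text \<open>On the graph of \<open>P\<close>, a zero of the state is a zero of the whole trajectory.\<close>

lemma riccati_solution_imp_invertible:
  assumes P: "riccati_solution_on J P" and XY: "matrix_trajectory X Y"
    and J: "is_interval J" "s \<in> J" "t \<in> J" and init: "X s = mat 1" "Y s = P s"
  shows "invertible (X t)"
proof (rule invertible_if_kernel_trivial)
  fix v assume "X t *v v = 0"
  moreover have "Y t *v v = P t *v (X t *v v)"
    using matrix_trajectory_mult_vector[OF XY] init
    by (intro riccati_solution_graph[OF P _ J]) auto
  ultimately have "X s *v v = 0"
    using trajectory_zero(1)[OF matrix_trajectory_mult_vector[OF XY]] by simp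
  then show "v = 0" by (simp add: init)
qed

lemma riccati_solution_of_invertible:
  fixes X Y :: "real \<Rightarrow> real^'n^'n"
  assumes XY: "matrix_trajectory X Y" and inv: "\<And>t. t \<in> J \<Longrightarrow> invertible (X t)"
  shows "riccati_solution_on J (\<lambda>t. Y t ** matrix_inv (X t))"
  unfolding riccati_solution_on_def
proof
  fix t assume t: "t \<in> J"
  let ?I = "matrix_inv (X t)"
  note d = XY[unfolded matrix_trajectory_def, rule_format, of t]
  have "((\<lambda>t. Y t ** matrix_inv (X t)) has_vector_derivative
      Y t ** (- (?I ** (A t ** X t - B t ** transpose (B t) ** Y t) ** ?I))
        + (- (Q t ** X t) - transpose (A t) ** Y t) ** ?I) (at t within J)"
    using d t inv
    by (intro bounded_bilinear.has_vector_derivative[OF bounded_bilinear_matrix_matrix_mult]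
        has_vector_derivative_matrix_inv) (auto intro: has_vector_derivative_at_within)
  moreover have "M ** X t ** ?I = M" for M :: "real^'n^'n"
    using matrix_inv_inverse(1)[OF inv[OF t]] by (simp add: matrix_mul_assoc[symmetric])
  ultimately show "((\<lambda>t. Y t ** matrix_inv (X t)) has_vector_derivative
      riccati_rhs A B Q t (Y t ** ?I)) (at t within J)"
    by (simp add: riccati_rhs_def matrix_mult_simps matrix_mul_assoc algebra_simps)
qed

text \<open>The bilinear form \<open>(X u) \<bullet> (Y v) - (X v) \<bullet> (Y u)\<close> is constant in time, and it vanishes at \<open>s\<close>
  because \<open>Y(s)\<close> is symmetric.\<close>

lemma matrix_trajectory_quotient_symmetric:
  assumes XY: "matrix_trajectory X Y" and init: "X s = mat 1" "sym_matrix (Y s)"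
    and inv: "invertible (X t)"
  shows "sym_matrix (Y t ** matrix_inv (X t))"
  unfolding sym_matrix_iff_inner
proof (intro allI)
  fix u v
  let ?I = "matrix_inv (X t)"
  have X: "X t *v (?I *v w) = w" for w
    using matrix_inv_inverse(1)[OF inv] by (simp add: matrix_vector_mul_assoc)
  have "(?I *v u) \<bullet> (Y s *v (?I *v v)) = (?I *v v) \<bullet> (Y s *v (?I *v u))"
    using init(2) unfolding sym_matrix_iff_inner by blast
  then show "u \<bullet> ((Y t ** ?I) *v v) = v \<bullet> ((Y t ** ?I) *v u)"
    using wronskian_constant[OF matrix_trajectory_mult_vector[OF XY, of "?I *v u"]
        matrix_trajectory_mult_vector[OF XY, of "?I *v v"], of t s]
    by (simp add: X init(1) matrix_vector_mul_assoc[symmetric])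
qed

subsection \<open>Comparison with the costate that steers to the origin\<close>

text \<open>With \<open>W = y - P x\<close>, the symmetry of \<open>P\<close> gives \<open>(x \<bullet> W)' = - |B\<^sup>T W|\<^sup>2\<close>. As \<open>x\<close> vanishes at \<open>t\<close>,
  the monotonicity of \<open>x \<bullet> W\<close> determines its sign at \<open>s\<close>. It cannot vanish there, for
  then \<open>B\<^sup>T W = 0\<close> throughout, \<open>x\<close> solves the closed-loop equation \<open>x' = (A - B B\<^sup>T P) x\<close>, and its
  zero at \<open>t\<close> would spread to \<open>s\<close>.\<close>

lemma riccati_below_steering_costate:
  assumes P: "riccati_solution_on (closed_segment s t) P"
    and P_sym: "\<And>r. r \<in> closed_segment s t \<Longrightarrow> sym_matrix (P r)"
    and traj: "trajectory x y" and x: "x s \<noteq> 0" "x t = 0" and "s \<noteq> t"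
  shows "0 < (t - s) * (x s \<bullet> (y s - P s *v x s))"
proof -
  define a b where "a = min s t" and "b = max s t"
  have J: "closed_segment s t = {a..b}" and ab: "a < b" "s \<in> {a..b}" "t \<in> {a..b}"
    using \<open>s \<noteq> t\<close> by (auto simp: a_def b_def closed_segment_eq_real_ivl)
  note P' = P[unfolded J]
  let ?W = "\<lambda>t. y t - P t *v x t"
  let ?BW = "\<lambda>t. transpose (B t) *v ?W t"
  let ?g = "\<lambda>t. x t \<bullet> ?W t"
  have g: "(?g has_vector_derivative - (?BW r \<bullet> ?BW r)) (at r within {a..b})"
    if r: "r \<in> {a..b}" for r
  proof -
    have "(x has_vector_derivative A r *v x r - B r *v (transpose (B r) *v y r)) (at r within {a..b})"
      using traj unfolding trajectory_def by (blast intro: has_vector_derivative_at_within)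
    from bounded_bilinear.has_vector_derivative[OF bounded_bilinear_inner this
        riccati_defect_derivative[OF P' traj r]]
    have "(?g has_vector_derivative
        x r \<bullet> ((P r ** B r ** transpose (B r) - transpose (A r)) *v ?W r)
        + (A r *v x r - B r *v (transpose (B r) *v y r)) \<bullet> ?W r) (at r within {a..b})" .
    moreover have "x r \<bullet> ((P r ** B r ** transpose (B r)) *v ?W r)
        = (transpose (B r) *v (P r *v x r)) \<bullet> ?BW r"
    proof -
      have "x r \<bullet> (P r *v (B r *v ?BW r)) = (B r *v ?BW r) \<bullet> (P r *v x r)"
        using P_sym r unfolding J sym_matrix_iff_inner by blast
      also have "\<dots> = ?BW r \<bullet> (transpose (B r) *v (P r *v x r))"
        by (simp add: inner_transpose_right)
      finally show ?thesis by (simp add: matrix_vector_mul_assoc matrix_mul_assoc inner_commute)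
    qed
    moreover have "(B r *v (transpose (B r) *v y r)) \<bullet> ?W r = (transpose (B r) *v y r) \<bullet> ?BW r"
      by (rule inner_transpose_right[symmetric])
    moreover have "(A r *v x r) \<bullet> ?W r = x r \<bullet> (transpose (A r) *v ?W r)"
      by (rule inner_transpose_right[symmetric])
    moreover have "?BW r \<bullet> ?BW r
        = (transpose (B r) *v y r) \<bullet> ?BW r - (transpose (B r) *v (P r *v x r)) \<bullet> ?BW r"
      by (simp only: inner_diff_left[symmetric] matrix_vector_mult_simps)
    ultimately show ?thesis
      by (simp only: matrix_vector_mult_diff_rdistrib inner_diff_left[of "A r *v x r"]
          inner_diff_right[of "x r" "_ *v ?W r"]) (simp add: algebra_simps)
  qed
  have anti: "?g q \<le> ?g p" if "p \<in> {a..b}" "q \<in> {a..b}" "p \<le> q" for p q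
    using that by (intro antitone_if_derivative_nonpos[OF g]) auto
  have gt: "?g t = 0" using x(2) by simp
  show ?thesis
  proof (rule ccontr)
    assume neg: "\<not> ?thesis"
    have gs: "?g s = 0"
    proof (cases "s < t")
      case True
      then show ?thesis
        using neg gt anti[OF ab(2,3)] by (simp add: zero_less_mult_iff)
    next
      case False
      then show ?thesis
        using neg gt anti[OF ab(3,2)] \<open>s \<noteq> t\<close> by (simp add: zero_less_mult_iff)
    qed
    have g0: "?g r = 0" if "r \<in> {a..b}" for r
    proof -
      have "?g a = 0" "?g b = 0" using gs gt by (auto simp: a_def b_def min_def max_def)
      then show ?thesis using anti[of a r] anti[of r b] that ab(1) by simp
    qed
    have "?BW r = 0" if "r \<in> {a..b}" for r
      using derivative_zero_if_constant[OF ab(1) that g0 g[OF that]] by simp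
    then have BW: "transpose (B r) *v y r = transpose (B r) *v (P r *v x r)" if "r \<in> {a..b}" for r
      using that by (simp add: matrix_vector_mult_simps)
    have "x s = 0"
    proof (rule linear_ode_solution_zero[where J = "{a..b}" and p = t and f = x
          and L = "\<lambda>r. A r - B r ** transpose (B r) ** P r"])
      show "(x has_vector_derivative (A r - B r ** transpose (B r) ** P r) *v x r) (at r within {a..b})"
        if "r \<in> {a..b}" for r
      proof -
        have "(A r - B r ** transpose (B r) ** P r) *v x r
            = A r *v x r - B r *v (transpose (B r) *v y r)"
          unfolding BW[OF that]
          by (simp add: matrix_vector_mult_simps matrix_vector_mul_assoc matrix_mul_assoc)
        then show ?thesis
          using traj unfolding trajectory_def by (metis has_vector_derivative_at_within)
      qed
      show "continuous_on {a..b} (\<lambda>r. A r - B r ** transpose (B r) ** P r)"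
        by (intro continuous_intros riccati_solution_continuous[OF P'] cont_on)
    qed (use ab x in \<open>auto simp: is_interval_cc\<close>)
    with x(1) show False by simp
  qed
qed

text \<open>At time \<open>r\<close> the Wronskian of the two trajectories is \<open>- (x2 \<bullet> y1)\<close>, and at time \<open>s\<close> it is
  the quantity to be bounded. The difference of the trajectories has zero state at \<open>s\<close> and
  state \<open>x2\<close> at \<open>r\<close>, so for \<open>s \<le> t\<close> its energy is nonpositive at \<open>r\<close>, which reads
  \<open>x2 \<bullet> y2 \<le> x2 \<bullet> y1\<close>; the second trajectory reaches zero state at \<open>t\<close>, so
  \<open>0 \<le> x2 \<bullet> y2\<close> at \<open>r\<close>. Both signs flip for \<open>t \<le> s\<close>.\<close>

lemma steering_costate_below_conjugate_trajectory:
  assumes "trajectory x1 y1" "trajectory x2 y2"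
    and eq: "x1 s = x2 s" and zero: "x2 t = 0" "x1 r = 0" and r: "r \<in> closed_segment s t"
  shows "(t - s) * (x2 s \<bullet> (y2 s - y1 s)) \<le> 0"
proof -
  have "x2 s \<bullet> (y2 s - y1 s) = - (x2 r \<bullet> y1 r)"
    using wronskian_constant[OF assms(1,2), of s r] eq zero by (simp add: inner_diff_right)
  moreover note d = energy_antitone[OF trajectory_diff[OF assms(2,1)]] energy_antitone[OF assms(2)]
  have "s \<le> t \<Longrightarrow> 0 \<le> x2 r \<bullet> y1 r"
    using d(1)[of s r] d(2)[of r t] r eq zero
    by (auto simp: inner_diff_right closed_segment_eq_real_ivl)
  moreover have "t \<le> s \<Longrightarrow> x2 r \<bullet> y1 r \<le> 0"
    using d(1)[of r s] d(2)[of t r] r eq zero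
    by (auto simp: inner_diff_right closed_segment_eq_real_ivl split: if_splits)
  ultimately show ?thesis
    by (cases "s \<le> t") (simp_all add: mult_nonpos_nonpos)
qed

end

section \<open>The maximal interval of existence\<close>

text \<open>The feedback \<open>y(s) = S x(s)\<close> under which the trajectory started at time \<open>s\<close> has zero state
  at time \<open>t\<close>.\<close>

definition steering_gain ::
  "(real \<Rightarrow> real \<Rightarrow> real^('n + 'n)^('n + 'n)) \<Rightarrow> real \<Rightarrow> real \<Rightarrow> real^'n^'n" where
  "steering_gain \<Phi> s t = - (matrix_inv (block12 (\<Phi> t s)) ** block11 (\<Phi> t s))"

locale riccati_initial_value_problem = hamiltonian_system A Q B
  for A Q :: "real \<Rightarrow> real^'n^'n" and B :: "real \<Rightarrow> real^'p^'n" +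
  fixes \<Phi> :: "real \<Rightarrow> real \<Rightarrow> real^('n + 'n)^('n + 'n)" and s :: real and P0 :: "real^'n^'n"
  assumes \<Phi>: "state_transition_matrix (hamiltonian A B Q) \<Phi>"
    and P0_sym: "sym_matrix P0"
    and block12_invertible: "\<And>t. t \<noteq> s \<Longrightarrow> invertible (block12 (\<Phi> t s))"
begin

definition state_matrix :: "real \<Rightarrow> real^'n^'n" where
  "state_matrix t = block11 (\<Phi> t s) + block12 (\<Phi> t s) ** P0"

lemma state_matrix_initial: "state_matrix s = mat 1"
  by (simp add: state_matrix_def transition_blocks_initial[OF \<Phi>])

lemma state_matrix_trajectory:
  obtains Y where "matrix_trajectory state_matrix Y" "Y s = P0"
  using matrix_trajectory_of_transition[OF \<Phi>, of s "mat 1" P0]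
  by (auto simp: state_matrix_def[abs_def])

lemma steering_trajectory:
  assumes "t \<noteq> s"
  obtains X Y where "matrix_trajectory X Y" "X s = mat 1" "Y s = steering_gain \<Phi> s t" "X t = 0"
proof -
  let ?X = "\<lambda>r. block11 (\<Phi> r s) ** mat 1 + block12 (\<Phi> r s) ** steering_gain \<Phi> s t"
  obtain Y where Y: "matrix_trajectory ?X Y" "Y s = steering_gain \<Phi> s t"
    by (rule matrix_trajectory_of_transition[OF \<Phi>])
  show thesis
  proof (rule that[OF Y(1) _ Y(2)])
    show "?X s = mat 1" by (simp add: transition_blocks_initial[OF \<Phi>])
    show "?X t = 0"
      using matrix_inv_inverse(1)[OF block12_invertible[OF assms]]
      by (simp add: steering_gain_def matrix_mult_simps matrix_mul_assoc)
  qed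
qed

text \<open>The Wronskian of two steering trajectories vanishes at \<open>t\<close>, where both states are zero.\<close>

lemma steering_gain_symmetric:
  assumes "t \<noteq> s"
  shows "sym_matrix (steering_gain \<Phi> s t)"
  unfolding sym_matrix_iff_inner
proof (intro allI)
  fix u v
  obtain X Y where XY: "matrix_trajectory X Y" "X s = mat 1" "Y s = steering_gain \<Phi> s t" "X t = 0"
    using steering_trajectory[OF assms] .
  show "u \<bullet> (steering_gain \<Phi> s t *v v) = v \<bullet> (steering_gain \<Phi> s t *v u)"
    using wronskian_constant[OF matrix_trajectory_mult_vector[OF XY(1), of u]
        matrix_trajectory_mult_vector[OF XY(1), of v], of s t]
    by (simp add: XY)
qed

text \<open>The factor \<open>t - s\<close> lets one condition express \<open>S(t) \<succ> P0\<close> after \<open>s\<close> and \<open>S(t) \<prec> P0\<close> before \<open>s\<close>.\<close>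

definition gain_gap_definite :: "real \<Rightarrow> bool" where
  "gain_gap_definite t \<longleftrightarrow>
     (\<forall>v. v \<noteq> 0 \<longrightarrow> 0 < (t - s) * (v \<bullet> ((steering_gain \<Phi> s t - P0) *v v)))"

lemma invertible_imp_gain_gap_definite:
  assumes inv: "\<And>r. r \<in> closed_segment s t \<Longrightarrow> invertible (state_matrix r)" and "t \<noteq> s"
  shows "gain_gap_definite t"
  unfolding gain_gap_definite_def
proof (intro allI impI)
  fix v :: "real^'n" assume "v \<noteq> 0"
  obtain Z where Z: "matrix_trajectory state_matrix Z" "Z s = P0"
    using state_matrix_trajectory .
  obtain X Y where XY: "matrix_trajectory X Y" "X s = mat 1" "Y s = steering_gain \<Phi> s t" "X t = 0"
    using steering_trajectory[OF \<open>t \<noteq> s\<close>] .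
  let ?P = "\<lambda>r. Z r ** matrix_inv (state_matrix r)"
  have Zs_sym: "sym_matrix (Z s)" using P0_sym by (simp add: Z)
  have Ps: "?P s = P0" by (simp add: Z state_matrix_initial matrix_inv_mat_1)
  have "0 < (t - s) * ((X s *v v) \<bullet> (Y s *v v - ?P s *v (X s *v v)))"
  proof (rule riccati_below_steering_costate[where P = ?P
        and x = "\<lambda>r. X r *v v" and y = "\<lambda>r. Y r *v v"])
    show "riccati_solution_on (closed_segment s t) ?P"
      using riccati_solution_of_invertible[OF Z(1) inv] .
    show "sym_matrix (?P r)" if "r \<in> closed_segment s t" for r
      by (rule matrix_trajectory_quotient_symmetric[OF Z(1) state_matrix_initial Zs_sym inv[OF that]])
    show "trajectory (\<lambda>r. X r *v v) (\<lambda>r. Y r *v v)"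
      by (rule matrix_trajectory_mult_vector[OF XY(1)])
    show "X s *v v \<noteq> 0" "X t *v v = 0" "s \<noteq> t"
      using XY \<open>v \<noteq> 0\<close> \<open>t \<noteq> s\<close> by simp_all
  qed
  moreover have "Y s *v v - ?P s *v (X s *v v) = (steering_gain \<Phi> s t - P0) *v v"
    unfolding Ps XY(2,3) by (simp add: matrix_vector_mult_simps)
  ultimately show "0 < (t - s) * (v \<bullet> ((steering_gain \<Phi> s t - P0) *v v))"
    unfolding XY(2) by simp
qed

lemma gain_gap_definite_imp_invertible:
  assumes def: "gain_gap_definite t" and "t \<noteq> s" and r: "r \<in> closed_segment s t"
  shows "invertible (state_matrix r)"
proof (rule invertible_if_kernel_trivial)
  fix v assume v: "state_matrix r *v v = 0"
  obtain Z where Z: "matrix_trajectory state_matrix Z" "Z s = P0"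
    using state_matrix_trajectory .
  obtain X Y where XY: "matrix_trajectory X Y" "X s = mat 1" "Y s = steering_gain \<Phi> s t" "X t = 0"
    using steering_trajectory[OF \<open>t \<noteq> s\<close>] .
  have "(t - s) * ((X s *v v) \<bullet> (Y s *v v - Z s *v v)) \<le> 0"
    by (rule steering_costate_below_conjugate_trajectory[OF
          matrix_trajectory_mult_vector[OF Z(1), of v]
          matrix_trajectory_mult_vector[OF XY(1), of v] _ _ v r])
       (simp_all add: XY state_matrix_initial)
  then have "\<not> 0 < (t - s) * (v \<bullet> ((steering_gain \<Phi> s t - P0) *v v))"
    by (simp add: XY Z matrix_vector_mult_simps)
  then show "v = 0" using def unfolding gain_gap_definite_def by blast
qed

lemma mem_max_existence_interval_iff:
  "t \<in> max_existence_interval (riccati_rhs A B Q) s P0 \<longleftrightarrow>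
     (\<forall>r\<in>closed_segment s t. invertible (state_matrix r))"
proof
  assume "t \<in> max_existence_interval (riccati_rhs A B Q) s P0"
  then obtain J P where J: "is_interval J" "s \<in> J" "t \<in> J"
    and P: "P s = P0" "riccati_solution_on J P"
    unfolding max_existence_interval_def solves_ivp_on_def riccati_solution_on_def by blast
  obtain Z where Z: "matrix_trajectory state_matrix Z" "Z s = P0"
    using state_matrix_trajectory .
  show "\<forall>r\<in>closed_segment s t. invertible (state_matrix r)"
  proof
    fix r assume "r \<in> closed_segment s t"
    then have "r \<in> J"
      using closed_segment_subset[OF J(2,3) is_interval_convex[OF J(1)]] by blast
    then show "invertible (state_matrix r)"
      using riccati_solution_imp_invertible[OF P(2) Z(1) J(1,2)] state_matrix_initial Z(2) P(1)
      by simp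
  qed
next
  assume inv: "\<forall>r\<in>closed_segment s t. invertible (state_matrix r)"
  obtain Z where Z: "matrix_trajectory state_matrix Z" "Z s = P0"
    using state_matrix_trajectory .
  have "solves_ivp_on (riccati_rhs A B Q) s P0 (\<lambda>r. Z r ** matrix_inv (state_matrix r))
      (closed_segment s t)"
    using riccati_solution_of_invertible[OF Z(1), of "closed_segment s t"] inv
    unfolding solves_ivp_on_def riccati_solution_on_def
    by (simp add: Z(2) state_matrix_initial matrix_inv_mat_1)
  moreover have "is_interval (closed_segment s t)"
    by (simp add: is_interval_convex_1)
  ultimately show "t \<in> max_existence_interval (riccati_rhs A B Q) s P0"
    unfolding max_existence_interval_def
    by (intro UnionI[of "closed_segment s t"]) auto
qed

text \<open>Openness is what makes the comparison with \<open>t\<^sub>0\<close> and \<open>t\<^sub>1\<close> strict in the theorem.\<close>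

lemma max_existence_interval_neighbourhood:
  assumes "t \<in> max_existence_interval (riccati_rhs A B Q) s P0"
  obtains d where "d > 0"
    "\<And>t'. \<bar>t' - t\<bar> < d \<Longrightarrow> t' \<in> max_existence_interval (riccati_rhs A B Q) s P0"
proof -
  have inv: "invertible (state_matrix r)" if "r \<in> closed_segment s t" for r
    using assms that unfolding mem_max_existence_interval_iff by blast
  obtain Z where Z: "matrix_trajectory state_matrix Z" "Z s = P0"
    using state_matrix_trajectory .
  have "isCont state_matrix t"
    using Z(1)[unfolded matrix_trajectory_def, rule_format, of t, THEN conjunct1]
    by (rule has_vector_derivative_continuous)
  then have "((\<lambda>r. det (state_matrix r)) \<longlongrightarrow> det (state_matrix t)) (at t)"
    unfolding isCont_def by (rule tendsto_det)
  moreover have "det (state_matrix t) \<noteq> 0"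
    using inv[of t] by (simp add: invertible_det_nz)
  ultimately have "\<forall>\<^sub>F r in at t. det (state_matrix r) \<noteq> 0"
    by (rule tendsto_imp_eventually_ne)
  then obtain d where d: "d > 0" "\<And>r. r \<noteq> t \<Longrightarrow> dist r t < d \<Longrightarrow> det (state_matrix r) \<noteq> 0"
    by (auto simp: eventually_at)
  have "t' \<in> max_existence_interval (riccati_rhs A B Q) s P0" if "\<bar>t' - t\<bar> < d" for t'
    unfolding mem_max_existence_interval_iff
  proof
    fix r assume "r \<in> closed_segment s t'"
    then have "r \<in> closed_segment s t \<or> \<bar>r - t\<bar> < d"
      using that by (auto simp: closed_segment_eq_real_ivl split: if_splits)
    then show "invertible (state_matrix r)"
      using inv d(2)[of r] by (cases "r = t") (auto simp: invertible_det_nz dist_real_def)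
  qed
  with d(1) show thesis by (rule that)
qed

lemma gain_gap_definite_iff_loewner:
  "s < t \<Longrightarrow> gain_gap_definite t \<longleftrightarrow> P0 \<prec>\<^sub>L steering_gain \<Phi> s t"
  "t < s \<Longrightarrow> gain_gap_definite t \<longleftrightarrow> steering_gain \<Phi> s t \<prec>\<^sub>L P0"
proof -
  have pos: "0 < (t - s) * c \<longleftrightarrow> 0 < c" if "s < t" for c
    using that by (simp add: zero_less_mult_iff)
  show "gain_gap_definite t \<longleftrightarrow> P0 \<prec>\<^sub>L steering_gain \<Phi> s t" if "s < t"
    unfolding gain_gap_definite_def loewner_less_def pos[OF that]
    using steering_gain_symmetric[of t] P0_sym that by simp
  have neg: "0 < (t - s) * (v \<bullet> ((M - N) *v v)) \<longleftrightarrow> 0 < v \<bullet> ((N - M) *v v)"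
    if "t < s" for v and M N :: "real^'n^'n"
    using that
    by (simp add: zero_less_mult_iff matrix_vector_mult_diff_rdistrib inner_diff_right)
  show "gain_gap_definite t \<longleftrightarrow> steering_gain \<Phi> s t \<prec>\<^sub>L P0" if "t < s"
    unfolding gain_gap_definite_def loewner_less_def neg[OF that]
    using steering_gain_symmetric[of t] P0_sym that by simp
qed

text \<open>By openness, membership of \<open>t\<close> extends to times slightly beyond both \<open>s\<close> and \<open>t\<close>, on either
  side; this also covers \<open>t = s\<close>, where the gap condition fails. In the other direction, a
  definite gap at \<open>a\<close> makes the state matrix invertible on all of the segment from \<open>s\<close> to
  \<open>a\<close>, and one of the two witnesses lies beyond \<open>t\<close>.\<close>

lemma mem_max_existence_interval_iff_gain_gap:
  "t \<in> max_existence_interval (riccati_rhs A B Q) s P0 \<longleftrightarrow>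
     (\<exists>t'<s. t' < t \<and> gain_gap_definite t') \<and> (\<exists>t'>s. t < t' \<and> gain_gap_definite t')"
    (is "t \<in> ?I \<longleftrightarrow> ?L \<and> ?R")
proof
  assume "t \<in> ?I"
  moreover have "s \<in> ?I"
    by (simp add: mem_max_existence_interval_iff state_matrix_initial invertible_mat_1)
  ultimately have "min s t \<in> ?I" "max s t \<in> ?I"
    by (simp_all add: min_def max_def)
  obtain c where c: "c > 0" "\<And>t'. \<bar>t' - min s t\<bar> < c \<Longrightarrow> t' \<in> ?I"
    by (rule max_existence_interval_neighbourhood[OF \<open>min s t \<in> ?I\<close>]) blast
  obtain d where d: "d > 0" "\<And>t'. \<bar>t' - max s t\<bar> < d \<Longrightarrow> t' \<in> ?I"
    by (rule max_existence_interval_neighbourhood[OF \<open>max s t \<in> ?I\<close>]) blast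
  have def: "gain_gap_definite t'" if "t' \<in> ?I" "t' \<noteq> s" for t'
    using that invertible_imp_gain_gap_definite[of t']
    unfolding mem_max_existence_interval_iff by blast
  have less: "min s t - c / 2 < s" "min s t - c / 2 < t" "s < max s t + d / 2" "t < max s t + d / 2"
    using c(1) d(1) by (auto simp: min_def max_def)
  have "min s t - c / 2 \<in> ?I" "max s t + d / 2 \<in> ?I"
    using c d by simp_all
  then have "gain_gap_definite (min s t - c / 2)" "gain_gap_definite (max s t + d / 2)"
    using less by (auto intro: def)
  with less show "?L \<and> ?R" by blast
next
  assume "?L \<and> ?R"
  then obtain a b where a: "a < s" "a < t" "gain_gap_definite a"
    and b: "s < b" "t < b" "gain_gap_definite b" by blast
  have "closed_segment s t \<subseteq> closed_segment s a \<or> closed_segment s t \<subseteq> closed_segment s b"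
    using a b by (auto simp: closed_segment_eq_real_ivl)
  then show "t \<in> ?I"
    using gain_gap_definite_imp_invertible[OF a(3)] gain_gap_definite_imp_invertible[OF b(3)]
      a(1) b(1)
    unfolding mem_max_existence_interval_iff by blast
qed

end

theorem corollary1:
  fixes A Q :: "real \<Rightarrow> real^'n^'n"
    and B :: "real \<Rightarrow> real^'p^'n"
    and \<Phi> :: "real \<Rightarrow> real \<Rightarrow> real^('n + 'n)^('n + 'n)"
    and s :: real and \<Pi>\<^sub>s :: "real^'n^'n" and t\<^sub>0 t\<^sub>1 :: ereal
  assumes A: "times_cont_diff (CARD('n) - 1) A"
    and B: "times_cont_diff (CARD('n)) B"
    and Q: "continuous_on UNIV Q" "\<And>t. sym_matrix (Q t)" "\<And>t. 0 \<preceq>\<^sub>L Q t"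
    and \<Phi>: "state_transition_matrix (hamiltonian A B Q) \<Phi>"
    and ctrb: "totally_controllable A B"
    and sym: "sym_matrix \<Pi>\<^sub>s"
    and t0: "t\<^sub>0 = Inf (ereal ` {t. t < s \<and>
               - (matrix_inv (block12 (\<Phi> t s)) ** block11 (\<Phi> t s)) \<prec>\<^sub>L \<Pi>\<^sub>s})"
    and t1: "t\<^sub>1 = Sup (ereal ` {t. t > s \<and>
               \<Pi>\<^sub>s \<prec>\<^sub>L - (matrix_inv (block12 (\<Phi> t s)) ** block11 (\<Phi> t s))})"
  shows "max_existence_interval (riccati_rhs A B Q) s \<Pi>\<^sub>s = {t. t\<^sub>0 < ereal t \<and> ereal t < t\<^sub>1}"
proof -
  interpret hamiltonian_system A Q B
    using times_cont_diff_imp_continuous[OF A] times_cont_diff_imp_continuous[OF B] Q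
    by unfold_locales (auto simp: loewner_le_def)
  interpret riccati_initial_value_problem A Q B \<Phi> s "\<Pi>\<^sub>s"
    using transition_block12_invertible[OF \<Phi> A B ctrb] \<Phi> sym by unfold_locales
  have "t\<^sub>0 < ereal t \<longleftrightarrow> (\<exists>t'<s. t' < t \<and> gain_gap_definite t')" for t
    unfolding t0 Inf_less_iff steering_gain_def[symmetric]
    by (auto simp: gain_gap_definite_iff_loewner)
  moreover have "ereal t < t\<^sub>1 \<longleftrightarrow> (\<exists>t'>s. t < t' \<and> gain_gap_definite t')" for t
    unfolding t1 less_Sup_iff steering_gain_def[symmetric]
    by (auto simp: gain_gap_definite_iff_loewner)
  ultimately show ?thesis
    by (auto simp: mem_max_existence_interval_iff_gain_gap)
qed

end
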